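(* Let $p$ be a prime, let $M$ be a loopless and coloopless $p$-matroid on the ground set $E$, represented over $GF(p)$ by a matrix $A$, and let $T\subset E$. If $M$ is an Eulerian matroid having a $PT$-decomposition, then the splitting matroid $M_T$ (obtained from $M$ via $A$) is Eulerian.
   Context: A $p$-matroid is a matroid representable over the prime field $GF(p)$. A matroid is Eulerian if its ground set is a union of pairwise disjoint circuits. Fix a matrix $A$ over $GF(p)$ representing $M$, with columns labeled by $E$; elements of $E$ are identified with the corresponding columns of $A$ in linear relations. Let $A_T$ be the matrix obtained from $A$ by adjoining an extra row with entries zero everywhere except in the columns corresponding to members of $T$, where the entry is $1$. The splitting matroid $M_T$ is the vector matroid of $A_T$. Let $C$ be a circuit of $M$ with $C\cap T\neq\emptyset$. It is called a $PT$-circuit of $M$ if it is also a circuit of $M_T$, and an $NPT$-circuit of $M$ if it is not a circuit of $M_T$. Let $\mathcal{C}_0$ be the collection of all $PT$-circuits of $M$ together with all circuits of $M$ containing no element of $T$. $PT$-dependent set: consider subsets of $E$ of the form $C\cup I$, where $C=\{u_1,\dots,u_l\}$ is an $NPT$-circuit of $M$ disjoint from an independent set $I=\{v_1,\dots,v_k\}$ of $M$, and $T\cap(C\cup I)\neq\emptyset$. Such a $C\cup I$ is a $PT$-dependent set if it contains no member of $\mathcal{C}_0$ and there are non-zero constants $\alpha_1,\dots,\alpha_l,\beta_1,\dots,\beta_k\in GF(p)$ such that $\sum_{i=1}^{l}\alpha_iu_i+\sum_{j=1}^{k}\beta_jv_j=0$ and the sum of the coefficients (in this relation) of the elements of $T\cap(C\cup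 I)$ is $0$ modulo $p$. Let $\mathcal{C}_1$ be the set of inclusion-minimal $PT$-dependent sets of $M$. Let $\mathcal{C}_2$ be the set of inclusion-minimal elements of the collection of all sets $C_1\cup C_2$, where $C_1,C_2$ are disjoint $NPT$-circuits of $M$ and $C_1\cup C_2$ contains no member of $\mathcal{C}_0$ and no member of $\mathcal{C}_1$. $PT$-decomposition: a collection $\{C_1,C_2,\dots,C_{2l-1},C_{2l},\dots,C_k\}$ ($2l\le k$) of pairwise disjoint circuits of $M$ with $E=C_1\cup C_2\cup\dots\cup C_k$ is a $PT$-decomposition of $M$ if for every $1\le j\le l$ we have $T\cap C_{2j-1}\neq\emptyset$, $T\cap C_{2j}\neq\emptyset$, and either $C_{2j-1}\cup C_{2j}\in\mathcal{C}_2$ or $C_{2j-1},C_{2j}$ are $PT$-circuits; and $C_j\in\mathcal{C}_0$ for all $j\in\{2l+1,2l+2,\dots,k\}$. *)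

theory Defs
  imports
    "Berlekamp_Zassenhaus.Finite_Field"
    "Jordan_Normal_Form.Matrix"
    "HOL-Library.Disjoint_Sets"
begin

record 'e indep_system =
  ground :: "'e set"
  indep :: "'e set \<Rightarrow> bool"

locale matroid =
  fixes M :: "'e indep_system"
  assumes finite_ground: "finite (ground M)"
    and indep_subset_ground: "indep M X \<Longrightarrow> X \<subseteq> ground M"
    and indep_empty: "indep M {}"
    and indep_mono: "indep M Y \<Longrightarrow> X \<subseteq> Y \<Longrightarrow> indep M X"
    and augmentation:
      "indep M X \<Longrightarrow> indep M Y \<Longrightarrow> card X < card Y \<Longrightarrow> \<exists>y\<in>Y - X. indep M (insert y X)"

definition circuit :: "'e indep_system \<Rightarrow> 'e set \<Rightarrow> bool" where
  "circuit M C \<longleftrightarrow> C \<subseteq> ground M \<and> \<not> indep M C \<and> (\<forall>D. D \<subset> C \<longrightarrow> indep M D)"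

definition basis :: "'e indep_system \<Rightarrow> 'e set \<Rightarrow> bool" where
  "basis M B \<longleftrightarrow> indep M B \<and> (\<forall>X. indep M X \<longrightarrow> B \<subseteq> X \<longrightarrow> X = B)"

definition loopless :: "'e indep_system \<Rightarrow> bool" where
  "loopless M \<longleftrightarrow> (\<forall>e\<in>ground M. \<not> circuit M {e})"

text \<open>A coloop is an element that lies in every basis.\<close>

definition coloopless :: "'e indep_system \<Rightarrow> bool" where
  "coloopless M \<longleftrightarrow> (\<forall>e\<in>ground M. \<exists>B. basis M B \<and> e \<notin> B)"

definition eulerian :: "'e indep_system \<Rightarrow> bool" where
  "eulerian M \<longleftrightarrow> (\<exists>\<C>. (\<forall>C\<in>\<C>. circuit M C) \<and> disjoint \<C> \<and> \<Union>\<C> = ground M)"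

text \<open>
  A matrix with \<open>m\<close> rows whose columns are labeled by a set \<open>E\<close> is given by the family of its
  columns, \<open>A e \<in> carrier_vec m\<close> for \<open>e \<in> E\<close>. The labels, not the column vectors, are
  the elements of the matroid, so repeated columns remain distinct (parallel) elements.
\<close>

definition lin_relation ::
    "nat \<Rightarrow> ('e \<Rightarrow> 'a::field vec) \<Rightarrow> 'e set \<Rightarrow> ('e \<Rightarrow> 'a) \<Rightarrow> bool" where
  "lin_relation m A X c \<longleftrightarrow> finsum_vec TYPE('a) m (\<lambda>e. c e \<cdot>\<^sub>v A e) X = 0\<^sub>v m"

definition vector_matroid :: "nat \<Rightarrow> ('e \<Rightarrow> 'a::field vec) \<Rightarrow> 'e set \<Rightarrow> 'e indep_system" where
  "vector_matroid m A E =
     \<lparr>ground = E,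
      indep = (\<lambda>X. X \<subseteq> E \<and> (\<forall>c. lin_relation m A X c \<longrightarrow> (\<forall>e\<in>X. c e = 0)))\<rparr>"

definition represents :: "nat \<Rightarrow> ('e \<Rightarrow> 'a::field vec) \<Rightarrow> 'e indep_system \<Rightarrow> bool" where
  "represents m A M \<longleftrightarrow>
     (\<forall>e\<in>ground M. A e \<in> carrier_vec m) \<and> M = vector_matroid m A (ground M)"

text \<open>The columns of \<open>A\<^sub>T\<close>; the additional row is put on top.\<close>

definition splitting_matrix :: "('e \<Rightarrow> 'a::field vec) \<Rightarrow> 'e set \<Rightarrow> 'e \<Rightarrow> 'a vec" where
  "splitting_matrix A T e = vCons (if e \<in> T then 1 else 0) (A e)"

definition splitting_matroid ::
    "nat \<Rightarrow> ('e \<Rightarrow> 'a::field vec) \<Rightarrow> 'e set \<Rightarrow> 'e indep_system \<Rightarrow> 'e indep_system" where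
  "splitting_matroid m A T M = vector_matroid (Suc m) (splitting_matrix A T) (ground M)"

definition PT_circuit ::
    "nat \<Rightarrow> ('e \<Rightarrow> 'a::field vec) \<Rightarrow> 'e set \<Rightarrow> 'e indep_system \<Rightarrow> 'e set \<Rightarrow> bool" where
  "PT_circuit m A T M C \<longleftrightarrow>
     circuit M C \<and> C \<inter> T \<noteq> {} \<and> circuit (splitting_matroid m A T M) C"

definition NPT_circuit ::
    "nat \<Rightarrow> ('e \<Rightarrow> 'a::field vec) \<Rightarrow> 'e set \<Rightarrow> 'e indep_system \<Rightarrow> 'e set \<Rightarrow> bool" where
  "NPT_circuit m A T M C \<longleftrightarrow>
     circuit M C \<and> C \<inter> T \<noteq> {} \<and> \<not> circuit (splitting_matroid m A T M) C"

definition circuits_C0 ::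
    "nat \<Rightarrow> ('e \<Rightarrow> 'a::field vec) \<Rightarrow> 'e set \<Rightarrow> 'e indep_system \<Rightarrow> 'e set set" where
  "circuits_C0 m A T M =
     {C. PT_circuit m A T M C} \<union> {C. circuit M C \<and> C \<inter> T = {}}"

definition PT_dependent ::
    "nat \<Rightarrow> ('e \<Rightarrow> 'a::field vec) \<Rightarrow> 'e set \<Rightarrow> 'e indep_system \<Rightarrow> 'e set \<Rightarrow> bool" where
  "PT_dependent m A T M X \<longleftrightarrow>
     (\<exists>C I. X = C \<union> I \<and> NPT_circuit m A T M C \<and> indep M I \<and> C \<inter> I = {} \<and> T \<inter> X \<noteq> {} \<and>
        (\<forall>D\<in>circuits_C0 m A T M. \<not> D \<subseteq> X) \<and>
        (\<exists>c. (\<forall>e\<in>X. c e \<noteq> 0) \<and> lin_relation m A X c \<and> (\<Sum>e\<in>T \<inter> X. c e) = 0))"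

definition inclusion_minimal :: "'e set set \<Rightarrow> 'e set set" where
  "inclusion_minimal \<S> = {X \<in> \<S>. \<forall>Y\<in>\<S>. Y \<subseteq> X \<longrightarrow> Y = X}"

definition sets_C1 ::
    "nat \<Rightarrow> ('e \<Rightarrow> 'a::field vec) \<Rightarrow> 'e set \<Rightarrow> 'e indep_system \<Rightarrow> 'e set set" where
  "sets_C1 m A T M = inclusion_minimal {X. PT_dependent m A T M X}"

definition sets_C2 ::
    "nat \<Rightarrow> ('e \<Rightarrow> 'a::field vec) \<Rightarrow> 'e set \<Rightarrow> 'e indep_system \<Rightarrow> 'e set set" where
  "sets_C2 m A T M = inclusion_minimal
     {C1 \<union> C2 | C1 C2. NPT_circuit m A T M C1 \<and> NPT_circuit m A T M C2 \<and> C1 \<inter> C2 = {} \<and>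
        (\<forall>D\<in>circuits_C0 m A T M. \<not> D \<subseteq> C1 \<union> C2) \<and>
        (\<forall>D\<in>sets_C1 m A T M. \<not> D \<subseteq> C1 \<union> C2)}"

definition PT_decomposition ::
    "nat \<Rightarrow> ('e \<Rightarrow> 'a::field vec) \<Rightarrow> 'e set \<Rightarrow> 'e indep_system \<Rightarrow>
     nat \<Rightarrow> nat \<Rightarrow> (nat \<Rightarrow> 'e set) \<Rightarrow> bool" where
  "PT_decomposition m A T M l k C \<longleftrightarrow>
     2 * l \<le> k \<and>
     (\<forall>j\<in>{1..k}. circuit M (C j)) \<and>
     disjoint_family_on C {1..k} \<and>
     ground M = (\<Union>j\<in>{1..k}. C j) \<and>
     (\<forall>j\<in>{1..l}. T \<inter> C (2 * j - 1) \<noteq> {} \<and> T \<inter> C (2 * j) \<noteq> {} \<and>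
        (C (2 * j - 1) \<union> C (2 * j) \<in> sets_C2 m A T M \<or>
         PT_circuit m A T M (C (2 * j - 1)) \<and> PT_circuit m A T M (C (2 * j)))) \<and>
     (\<forall>j\<in>{2 * l + 1..k}. C j \<in> circuits_C0 m A T M)"

end

theory Submission
  imports Defs
begin

text \<open>
  Every linear relation for \<open>A\<^sub>T\<close> is a relation for \<open>A\<close> whose coefficients on \<open>T\<close> sum to zero, so
  passing from \<open>M\<close> to \<open>M\<^sub>T\<close> can only create independent sets. Each piece of the decomposition is
  turned into circuits of \<open>M\<^sub>T\<close>, and these are then collected. The pieces in \<open>\<C>\<^sub>0\<close> stay circuits:
  the \<open>PT\<close>-circuits by definition, the circuits avoiding \<open>T\<close> because the new row vanishes on them.

  The substance is that a member \<open>X\<close> of \<open>\<C>\<^sub>2\<close> is a single circuit of \<open>M\<^sub>T\<close>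
  (\<open>sets_C2_circuit_splitting\<close>). Let \<open>X\<close> be the disjoint union of two \<open>NPT\<close>-circuits. Each of these
  carries a relation whose sum over \<open>T\<close> is not zero, and a suitable combination of the two relations
  has sum zero, so \<open>X\<close> is dependent in \<open>M\<^sub>T\<close> and contains a circuit \<open>D\<close> of \<open>M\<^sub>T\<close>. Now \<open>D\<close> is
  dependent in \<open>M\<close> and contains no member of \<open>\<C>\<^sub>0\<close>, so it contains an \<open>NPT\<close>-circuit \<open>C'\<close>. If
  \<open>D - C'\<close> were independent in \<open>M\<close>, then \<open>D\<close> would be a \<open>PT\<close>-dependent set inside \<open>X\<close>, which \<open>\<C>\<^sub>2\<close>
  excludes. Hence \<open>D - C'\<close> contains a second \<open>NPT\<close>-circuit, and the minimality of \<open>X\<close> among unions of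
  two disjoint \<open>NPT\<close>-circuits forces \<open>D = X\<close>.
\<close>

section \<open>Minimal sets and relations in vector matroids\<close>

lemma dependent_contains_circuit:
  assumes "finite X" "X \<subseteq> ground M" "\<not> indep M X"
  shows "\<exists>C\<subseteq>X. circuit M C"
  using assms
proof (induction X rule: finite_psubset_induct)
  case (psubset X)
  show ?case
  proof (cases "\<exists>D. D \<subset> X \<and> \<not> indep M D")
    case True
    then show ?thesis using psubset by (meson order.trans psubset_imp_subset)
  next
    case False
    then show ?thesis using psubset.prems unfolding circuit_def by blast
  qed
qed

lemma contains_inclusion_minimal:
  assumes "finite X" "X \<in> \<S>"
  shows "\<exists>Y\<in>inclusion_minimal \<S>. Y \<subseteq> X"
  using assms
proof (induction X rule: finite_psubset_induct)
  case (psubset X)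
  show ?case
  proof (cases "\<exists>Y\<in>\<S>. Y \<subset> X")
    case True
    then obtain Y where Y: "Y \<in> \<S>" "Y \<subset> X" by blast
    then show ?thesis using psubset.IH[OF Y(2,1)] by blast
  next
    case False
    then have "X \<in> inclusion_minimal \<S>"
      using psubset.prems by (auto simp: inclusion_minimal_def)
    then show ?thesis by blast
  qed
qed

lemma indep_vector_matroid:
  "indep (vector_matroid m A E) X \<longleftrightarrow>
     X \<subseteq> E \<and> (\<forall>c. lin_relation m A X c \<longrightarrow> (\<forall>e\<in>X. c e = 0))"
  by (simp add: vector_matroid_def)

lemma ground_vector_matroid [simp]: "ground (vector_matroid m A E) = E"
  by (simp add: vector_matroid_def)

lemma sum_times_indicator:
  fixes f :: "'b \<Rightarrow> 'a::semiring_1"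
  assumes "finite X"
  shows "(\<Sum>e\<in>X. f e * (if e \<in> T then 1 else 0)) = (\<Sum>e\<in>T \<inter> X. f e)"
proof -
  have "(\<Sum>e\<in>X. f e * (if e \<in> T then 1 else 0)) = (\<Sum>e\<in>X. if e \<in> T then f e else 0)"
    by (rule sum.cong) auto
  also have "\<dots> = (\<Sum>e\<in>X \<inter> T. f e)"
    using assms by (rule sum.inter_restrict[symmetric])
  finally show ?thesis by (simp add: Int_commute)
qed

lemma lin_relation_componentwise:
  fixes A :: "'e \<Rightarrow> 'a::field vec"
  assumes "finite X" "A \<in> X \<rightarrow> carrier_vec m"
  shows "lin_relation m A X c \<longleftrightarrow> (\<forall>i<m. (\<Sum>e\<in>X. c e * A e $ i) = 0)"
proof -
  have carrier: "(\<lambda>e. c e \<cdot>\<^sub>v A e) \<in> X \<rightarrow> carrier_vec m"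
    using assms(2) by auto
  have component: "finsum_vec TYPE('a) m (\<lambda>e. c e \<cdot>\<^sub>v A e) X $ i = (\<Sum>e\<in>X. c e * A e $ i)"
    if "i < m" for i
  proof -
    have "finsum_vec TYPE('a) m (\<lambda>e. c e \<cdot>\<^sub>v A e) X $ i = (\<Sum>e\<in>X. (c e \<cdot>\<^sub>v A e) $ i)"
      using index_finsum_vec[OF assms(1) that carrier] .
    also have "\<dots> = (\<Sum>e\<in>X. c e * A e $ i)"
    proof (rule sum.cong)
      fix e assume "e \<in> X"
      then have "A e \<in> carrier_vec m" using assms(2) by blast
      then show "(c e \<cdot>\<^sub>v A e) $ i = c e * A e $ i" using that by simp
    qed simp
    finally show ?thesis .
  qed
  have "finsum_vec TYPE('a) m (\<lambda>e. c e \<cdot>\<^sub>v A e) X \<in> carrier_vec m"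
    by (rule finsum_vec_closed[OF carrier])
  then show ?thesis
    unfolding lin_relation_def using component by (auto simp: vec_eq_iff)
qed

text \<open>Dropping the elements with coefficient zero turns any relation on a circuit into one on a
  smaller set, which must be trivial by minimality.\<close>

lemma circuit_relation_nowhere_zero:
  assumes "finite E" "A \<in> E \<rightarrow> carrier_vec m"
    and C: "circuit (vector_matroid m A E) C"
  obtains c where "lin_relation m A C c" "\<And>e. e \<in> C \<Longrightarrow> c e \<noteq> 0"
proof -
  have CE: "C \<subseteq> E" and dep: "\<not> indep (vector_matroid m A E) C"
    and min: "\<And>D. D \<subset> C \<Longrightarrow> indep (vector_matroid m A E) D"
    using C by (auto simp: circuit_def)
  have fin: "finite C" using CE assms(1) finite_subset by blast
  obtain c where c: "lin_relation m A C c" and nz: "\<exists>e\<in>C. c e \<noteq> 0"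
    using dep CE by (auto simp: indep_vector_matroid)
  let ?S = "{e \<in> C. c e \<noteq> 0}"
  have sums: "(\<Sum>e\<in>?S. c e * A e $ i) = (\<Sum>e\<in>C. c e * A e $ i)" for i
    by (rule sum.mono_neutral_left) (use fin in auto)
  have col: "A \<in> C \<rightarrow> carrier_vec m"
    using CE assms(2) by auto
  then have "finite ?S" and "A \<in> ?S \<rightarrow> carrier_vec m"
    using fin by auto
  then have "lin_relation m A ?S c"
    using c sums lin_relation_componentwise[OF fin col] lin_relation_componentwise[of ?S A m]
    by simp
  then have "\<not> indep (vector_matroid m A E) ?S"
    using nz unfolding indep_vector_matroid by blast
  then have "?S = C" using min[of ?S] by blast
  then show thesis using that c by blast
qed

lemma lin_relation_splitting_matrix:
  assumes "finite X" "A \<in> X \<rightarrow> carrier_vec m"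
  shows "lin_relation (Suc m) (splitting_matrix A T) X c \<longleftrightarrow>
    lin_relation m A X c \<and> (\<Sum>e\<in>T \<inter> X. c e) = 0"
proof -
  have carrier: "splitting_matrix A T \<in> X \<rightarrow> carrier_vec (Suc m)"
    using assms(2) by (auto simp: splitting_matrix_def)
  show ?thesis
    unfolding lin_relation_componentwise[OF assms(1) carrier] lin_relation_componentwise[OF assms]
    by (simp add: splitting_matrix_def All_less_Suc2 sum_times_indicator[OF assms(1)] conj_commute)
qed

section \<open>Circuits of the splitting matroid\<close>

context
  fixes M :: "'e indep_system" and m :: nat and A :: "'e \<Rightarrow> 'a::field vec" and T :: "'e set"
  assumes finite_ground: "finite (ground M)" and represents: "represents m A M"
begin

lemma columns_carrier: "A \<in> ground M \<rightarrow> carrier_vec m"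
  using represents by (simp add: represents_def)

lemma matroid_eq: "M = vector_matroid m A (ground M)"
  using represents by (simp add: represents_def)

lemma finite_subset_ground: "X \<subseteq> ground M \<Longrightarrow> finite X"
  using finite_ground finite_subset by blast

lemma indep_iff:
  "indep M X \<longleftrightarrow> X \<subseteq> ground M \<and> (\<forall>c. lin_relation m A X c \<longrightarrow> (\<forall>e\<in>X. c e = 0))"
  using arg_cong[OF matroid_eq, of "\<lambda>N. indep N X"] unfolding indep_vector_matroid .

lemma ground_splitting: "ground (splitting_matroid m A T M) = ground M"
  by (simp add: splitting_matroid_def)

lemma lin_relation_splitting:
  assumes "X \<subseteq> ground M"
  shows "lin_relation (Suc m) (splitting_matrix A T) X c \<longleftrightarrow>
    lin_relation m A X c \<and> (\<Sum>e\<in>T \<inter> X. c e) = 0"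
  by (rule lin_relation_splitting_matrix) (use assms columns_carrier finite_subset_ground in auto)

lemma indep_splitting_iff:
  "indep (splitting_matroid m A T M) X \<longleftrightarrow> X \<subseteq> ground M \<and>
     (\<forall>c. lin_relation m A X c \<and> (\<Sum>e\<in>T \<inter> X. c e) = 0 \<longrightarrow> (\<forall>e\<in>X. c e = 0))"
  unfolding splitting_matroid_def indep_vector_matroid using lin_relation_splitting by blast

lemma indep_splittingI: "indep M X \<Longrightarrow> indep (splitting_matroid m A T M) X"
  by (auto simp: indep_iff indep_splitting_iff)

text \<open>Proper subsets of a circuit of \<open>M\<close> remain independent in \<open>M\<^sub>T\<close>, so the circuit survives as
  soon as it is dependent there.\<close>

lemma circuit_splittingI:
  assumes "circuit M C" "\<not> indep (splitting_matroid m A T M) C"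
  shows "circuit (splitting_matroid m A T M) C"
  using assms indep_splittingI by (auto simp: circuit_def ground_splitting)

lemma circuits_C0_circuit_splitting:
  assumes "C \<in> circuits_C0 m A T M"
  shows "circuit (splitting_matroid m A T M) C"
proof (cases "PT_circuit m A T M C")
  case True
  then show ?thesis by (simp add: PT_circuit_def)
next
  case False
  then have C: "circuit M C" "T \<inter> C = {}"
    using assms by (auto simp: circuits_C0_def)
  then have "\<not> indep (splitting_matroid m A T M) C"
    by (auto simp: circuit_def indep_iff indep_splitting_iff)
  then show ?thesis by (rule circuit_splittingI[OF C(1)])
qed

lemma circuit_relation:
  assumes "circuit M C"
  obtains c where "lin_relation m A C c" "\<And>e. e \<in> C \<Longrightarrow> c e \<noteq> 0"
proof -
  have "circuit (vector_matroid m A (ground M)) C"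
    using assms by (rule back_subst[OF _ arg_cong[OF matroid_eq, of "\<lambda>N. circuit N C"]])
  then show thesis
    using circuit_relation_nowhere_zero[OF finite_ground columns_carrier] that by blast
qed

lemma circuit_splitting_relation:
  assumes "circuit (splitting_matroid m A T M) D"
  obtains c where "lin_relation m A D c" "(\<Sum>e\<in>T \<inter> D. c e) = 0" "\<And>e. e \<in> D \<Longrightarrow> c e \<noteq> 0"
proof -
  have D: "D \<subseteq> ground M" using assms by (simp add: circuit_def ground_splitting)
  have carrier: "splitting_matrix A T \<in> ground M \<rightarrow> carrier_vec (Suc m)"
    using columns_carrier by (auto simp: splitting_matrix_def)
  obtain c where "lin_relation (Suc m) (splitting_matrix A T) D c" "\<And>e. e \<in> D \<Longrightarrow> c e \<noteq> 0"
    using circuit_relation_nowhere_zero[OF finite_ground carrier] assms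
    unfolding splitting_matroid_def by blast
  then show thesis using that lin_relation_splitting[OF D] by blast
qed

text \<open>A relation on an \<open>NPT\<close>-circuit with sum zero over \<open>T\<close> would make it dependent in \<open>M\<^sub>T\<close>,
  and hence a circuit there.\<close>

lemma NPT_circuit_relation:
  assumes "NPT_circuit m A T M C"
  obtains c where "lin_relation m A C c" "\<And>e. e \<in> C \<Longrightarrow> c e \<noteq> 0" "(\<Sum>e\<in>T \<inter> C. c e) \<noteq> 0"
proof -
  have C: "circuit M C" "C \<inter> T \<noteq> {}" "\<not> circuit (splitting_matroid m A T M) C"
    using assms by (auto simp: NPT_circuit_def)
  obtain c where c: "lin_relation m A C c" "\<And>e. e \<in> C \<Longrightarrow> c e \<noteq> 0"
    using circuit_relation[OF C(1)] by blast
  have "(\<Sum>e\<in>T \<inter> C. c e) \<noteq> 0"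
  proof
    assume "(\<Sum>e\<in>T \<inter> C. c e) = 0"
    then have "\<not> indep (splitting_matroid m A T M) C"
      using c C(2) by (auto simp: indep_splitting_iff)
    then show False using C circuit_splittingI by blast
  qed
  then show thesis using that c by blast
qed

lemma NPT_circuits_dependent_splitting:
  assumes C1: "NPT_circuit m A T M C1" and C2: "NPT_circuit m A T M C2" and disj: "C1 \<inter> C2 = {}"
  shows "\<not> indep (splitting_matroid m A T M) (C1 \<union> C2)"
proof -
  have sub: "C1 \<subseteq> ground M" "C2 \<subseteq> ground M" and ne: "C1 \<noteq> {}"
    using C1 C2 by (auto simp: NPT_circuit_def circuit_def)
  note fin = finite_subset_ground[OF sub(1)] finite_subset_ground[OF sub(2)]
  obtain c1 where c1: "lin_relation m A C1 c1" "\<And>e. e \<in> C1 \<Longrightarrow> c1 e \<noteq> 0"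
    "(\<Sum>e\<in>T \<inter> C1. c1 e) \<noteq> 0" using NPT_circuit_relation[OF C1] by blast
  obtain c2 where c2: "lin_relation m A C2 c2" "(\<Sum>e\<in>T \<inter> C2. c2 e) \<noteq> 0"
    using NPT_circuit_relation[OF C2] by blast
  define t1 where "t1 = (\<Sum>e\<in>T \<inter> C1. c1 e)"
  define t2 where "t2 = (\<Sum>e\<in>T \<inter> C2. c2 e)"
  \<comment> \<open>The multipliers \<open>t2\<close> and \<open>- t1\<close> make the contributions of the two circuits to the sum over
    \<open>T\<close> cancel.\<close>
  define c where "c = (\<lambda>e. if e \<in> C1 then t2 * c1 e else - t1 * c2 e)"
  have split: "(\<Sum>e\<in>C1 \<union> C2. c e * f e) =
      t2 * (\<Sum>e\<in>C1. c1 e * f e) - t1 * (\<Sum>e\<in>C2. c2 e * f e)" for f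
  proof -
    have "(\<Sum>e\<in>C1 \<union> C2. c e * f e) = (\<Sum>e\<in>C1. c e * f e) + (\<Sum>e\<in>C2. c e * f e)"
      using fin disj by (rule sum.union_disjoint)
    also have "(\<Sum>e\<in>C1. c e * f e) = t2 * (\<Sum>e\<in>C1. c1 e * f e)"
      by (simp add: c_def sum_distrib_left mult.assoc)
    also have "(\<Sum>e\<in>C2. c e * f e) = (\<Sum>e\<in>C2. - t1 * (c2 e * f e))"
      using disj by (intro sum.cong) (auto simp: c_def mult.assoc)
    also have "\<dots> = - t1 * (\<Sum>e\<in>C2. c2 e * f e)"
      by (rule sum_distrib_left[symmetric])
    finally show ?thesis by simp
  qed
  have "A \<in> C1 \<rightarrow> carrier_vec m" "A \<in> C2 \<rightarrow> carrier_vec m" "A \<in> C1 \<union> C2 \<rightarrow> carrier_vec m"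
    using columns_carrier sub by auto
  then have "lin_relation m A (C1 \<union> C2) c"
    using c1(1) c2(1) fin by (simp add: lin_relation_componentwise split)
  moreover have "(\<Sum>e\<in>T \<inter> (C1 \<union> C2). c e) = 0"
  proof -
    have "(\<Sum>e\<in>T \<inter> (C1 \<union> C2). c e) = t2 * t1 - t1 * t2"
      using split[of "\<lambda>e. if e \<in> T then 1 else 0"] fin
      by (simp only: sum_times_indicator finite_UnI t1_def t2_def)
    then show ?thesis by simp
  qed
  moreover have "\<exists>e\<in>C1 \<union> C2. c e \<noteq> 0"
    using ne c1(2) c2(2) by (auto simp: c_def t2_def)
  ultimately show ?thesis by (auto simp: indep_splitting_iff)
qed

lemma sets_C2_circuit_splitting:
  assumes X: "X \<in> sets_C2 m A T M"
  shows "circuit (splitting_matroid m A T M) X"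
proof -
  define good where "good = (\<lambda>Y.
    (\<forall>D\<in>circuits_C0 m A T M. \<not> D \<subseteq> Y) \<and> (\<forall>D\<in>sets_C1 m A T M. \<not> D \<subseteq> Y))"
  define \<S> where "\<S> = {C1 \<union> C2 | C1 C2. NPT_circuit m A T M C1 \<and> NPT_circuit m A T M C2 \<and>
    C1 \<inter> C2 = {} \<and> good (C1 \<union> C2)}"
  have "X \<in> inclusion_minimal \<S>"
    using X by (simp only: sets_C2_def \<S>_def good_def)
  then have XS: "X \<in> \<S>" and XS_min: "\<And>Y. Y \<in> \<S> \<Longrightarrow> Y \<subseteq> X \<Longrightarrow> Y = X"
    by (auto simp: inclusion_minimal_def)
  obtain C1 C2 where C12: "X = C1 \<union> C2" "NPT_circuit m A T M C1" "NPT_circuit m A T M C2"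
      "C1 \<inter> C2 = {}" and good: "good X"
    using XS unfolding \<S>_def by auto
  have no_C0: "\<not> D \<subseteq> X" if "D \<in> circuits_C0 m A T M" for D
    using good that by (simp add: good_def)
  have no_C1: "\<not> D \<subseteq> X" if "D \<in> sets_C1 m A T M" for D
    using good that by (simp add: good_def)
  have minimal: "C1' \<union> C2' = X" if "NPT_circuit m A T M C1'" "NPT_circuit m A T M C2'"
      "C1' \<inter> C2' = {}" "C1' \<union> C2' \<subseteq> X" for C1' C2'
  proof -
    have "good (C1' \<union> C2')"
      using good that(4) unfolding good_def by (meson order.trans)
    then have "C1' \<union> C2' \<in> \<S>"
      using that(1-3) unfolding \<S>_def by blast
    then show ?thesis using that(4) by (rule XS_min)
  qed
  have XE: "X \<subseteq> ground M"
    using C12 by (auto simp: NPT_circuit_def circuit_def)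
  have NPT: "NPT_circuit m A T M C" if "circuit M C" "C \<subseteq> X" for C
    using that no_C0[of C] by (auto simp: circuits_C0_def PT_circuit_def NPT_circuit_def)
  have circuit_within: "\<exists>C\<subseteq>Y. NPT_circuit m A T M C" if Y: "Y \<subseteq> X" "\<not> indep M Y" for Y
  proof -
    have "Y \<subseteq> ground M" using Y(1) XE by (rule order.trans)
    then obtain C where C: "C \<subseteq> Y" "circuit M C"
      using dependent_contains_circuit[OF finite_subset_ground _ Y(2)] by blast
    then have "NPT_circuit m A T M C" using NPT Y(1) by (meson order.trans)
    then show ?thesis using C(1) by blast
  qed
  obtain D where D: "D \<subseteq> X" "circuit (splitting_matroid m A T M) D"
    using dependent_contains_circuit[of X "splitting_matroid m A T M"] XE finite_subset_ground[OF XE]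
      NPT_circuits_dependent_splitting[OF C12(2-4)] C12(1) by (auto simp: ground_splitting)
  have "\<not> indep M D" using D indep_splittingI by (auto simp: circuit_def)
  then obtain C' where C': "C' \<subseteq> D" "NPT_circuit m A T M C'"
    using circuit_within D by blast
  have "\<not> indep M (D - C')"
  proof
    assume I: "indep M (D - C')"
    obtain c where c: "lin_relation m A D c" "(\<Sum>e\<in>T \<inter> D. c e) = 0" "\<And>e. e \<in> D \<Longrightarrow> c e \<noteq> 0"
      using circuit_splitting_relation[OF D(2)] by blast
    have "PT_dependent m A T M D"
      unfolding PT_dependent_def
    proof (rule exI[of _ C'], rule exI[of _ "D - C'"], intro conjI)
      show "T \<inter> D \<noteq> {}" using C' by (auto simp: NPT_circuit_def)
      show "\<forall>C\<in>circuits_C0 m A T M. \<not> C \<subseteq> D" using no_C0 D by blast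
      show "\<exists>c. (\<forall>e\<in>D. c e \<noteq> 0) \<and> lin_relation m A D c \<and> (\<Sum>e\<in>T \<inter> D. c e) = 0"
        using c by blast
    qed (use C' I in auto)
    then obtain Y where "Y \<in> sets_C1 m A T M" "Y \<subseteq> D"
      using contains_inclusion_minimal[of D "{X. PT_dependent m A T M X}"]
        finite_subset_ground[of D] D XE unfolding sets_C1_def by auto
    then show False using no_C1 D by blast
  qed
  then obtain C'' where C'': "C'' \<subseteq> D - C'" "NPT_circuit m A T M C''"
    using circuit_within[of "D - C'"] D by blast
  \<comment> \<open>\<open>C'\<close> and \<open>C''\<close> lie in \<open>D \<subseteq> X\<close>, so the circuit \<open>D\<close> of \<open>M\<^sub>T\<close> is all of \<open>X\<close>.\<close>
  have "C' \<union> C'' = X" using C' C'' D by (intro minimal) auto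
  then have "D = X" using C' C'' D by blast
  then show ?thesis using D by simp
qed

end

section \<open>Assembling the decomposition\<close>

lemma disjoint_decomposition_UN:
  assumes "\<And>i. i \<in> I \<Longrightarrow> \<exists>\<C>. (\<forall>C\<in>\<C>. P C) \<and> disjoint \<C> \<and> \<Union>\<C> = F i"
    and "disjoint_family_on F I"
  shows "\<exists>\<C>. (\<forall>C\<in>\<C>. P C) \<and> disjoint \<C> \<and> \<Union>\<C> = (\<Union>i\<in>I. F i)"
proof -
  obtain \<G> where \<G>: "\<forall>i\<in>I. (\<forall>C\<in>\<G> i. P C) \<and> disjoint (\<G> i) \<and> \<Union>(\<G> i) = F i"
    using bchoice[of I "\<lambda>i \<C>. (\<forall>C\<in>\<C>. P C) \<and> disjoint \<C> \<and> \<Union>\<C> = F i"] assms(1) by auto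
  have "disjoint_family_on (\<lambda>i. \<Union>(\<G> i)) I"
    using assms(2) \<G> by (simp add: disjoint_family_on_def)
  then have "disjoint (\<Union>i\<in>I. \<G> i)"
    using \<G> by (intro disjoint_UN) auto
  moreover have "\<Union>(\<Union>i\<in>I. \<G> i) = (\<Union>i\<in>I. F i)"
  proof -
    have "\<Union>(\<Union>i\<in>I. \<G> i) = (\<Union>i\<in>I. \<Union>(\<G> i))" by blast
    also have "\<dots> = (\<Union>i\<in>I. F i)" using \<G> by (intro SUP_cong) auto
    finally show ?thesis .
  qed
  moreover have "\<forall>C\<in>(\<Union>i\<in>I. \<G> i). P C"
    using \<G> by blast
  ultimately show ?thesis by (intro exI[of _ "\<Union>i\<in>I. \<G> i"] conjI)
qed

theorem proposition4p4:
  fixes M :: "'e indep_system"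
    and m :: nat
    and A :: "'e \<Rightarrow> 'p::prime_card mod_ring vec"
    and T :: "'e set"
  assumes "matroid M"
    and "represents m A M"
    and "loopless M"
    and "coloopless M"
    and "T \<subseteq> ground M"
    and "eulerian M"
    and "\<exists>l k C. PT_decomposition m A T M l k C"
  shows "eulerian (splitting_matroid m A T M)"
proof -
  have fin: "finite (ground M)" using assms(1) by (simp add: matroid_def)
  let ?P = "circuit (splitting_matroid m A T M)"
  let ?Q = "\<lambda>X. \<exists>\<C>. (\<forall>C\<in>\<C>. ?P C) \<and> disjoint \<C> \<and> \<Union>\<C> = X"
  obtain l k C where "PT_decomposition m A T M l k C" using assms(7) by blast
  then have lk: "2 * l \<le> k" and disj: "disjoint_family_on C {1..k}"
    and E: "ground M = (\<Union>j\<in>{1..k}. C j)"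
    and pairs: "\<And>j. j \<in> {1..l} \<Longrightarrow> C (2 * j - 1) \<union> C (2 * j) \<in> sets_C2 m A T M \<or>
        PT_circuit m A T M (C (2 * j - 1)) \<and> PT_circuit m A T M (C (2 * j))"
    and singles: "\<And>j. j \<in> {2 * l + 1..k} \<Longrightarrow> C j \<in> circuits_C0 m A T M"
    unfolding PT_decomposition_def by auto
  have C_disj: "C i \<inter> C j = {}" if "i \<in> {1..k}" "j \<in> {1..k}" "i \<noteq> j" for i j
    using disj that by (auto simp: disjoint_family_on_def)
  \<comment> \<open>The pairs, numbered \<open>1..l\<close>, and the single circuits, numbered \<open>2 * l + 1..k\<close>, are indexed by
    one set; the two ranges do not meet, so \<open>i \<le> l\<close> tells them apart.\<close>
  define J where "J = (\<lambda>i. if i \<le> l then {2 * i - 1, 2 * i} else {i})"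
  let ?I = "{1..l} \<union> {2 * l + 1..k}"
  have J_sub: "J i \<subseteq> {1..k}" if "i \<in> ?I" for i
    using that lk by (auto simp: J_def)
  have J_disj: "J i \<inter> J j = {}" if "i \<in> ?I" "j \<in> ?I" "i \<noteq> j" for i j
    using that by (auto simp: J_def)
  have J_cover: "(\<Union>i\<in>?I. J i) = {1..k}"
  proof
    show "{1..k} \<subseteq> (\<Union>i\<in>?I. J i)"
    proof
      fix j assume j: "j \<in> {1..k}"
      show "j \<in> (\<Union>i\<in>?I. J i)"
      proof (cases "j \<le> 2 * l")
        case True
        define i where "i = (j + 1) div 2"
        have "1 \<le> i" "i \<le> l" "j = 2 * i - 1 \<or> j = 2 * i"
          using True j unfolding i_def by auto
        then have "i \<in> ?I" "j \<in> J i"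
          by (auto simp: J_def)
        then show ?thesis by blast
      next
        case False
        then have "j \<in> ?I" "j \<in> J j" using j by (auto simp: J_def)
        then show ?thesis by blast
      qed
    qed
  qed (use J_sub in blast)
  let ?F = "\<lambda>i. \<Union>(C ` J i)"
  have "?Q (?F i)" if i: "i \<in> ?I" for i
  proof (cases "i \<le> l")
    case True
    then have i': "i \<in> {1..l}" using i by auto
    have "C (2 * i - 1) \<inter> C (2 * i) = {}"
      using i' lk by (intro C_disj) auto
    then have two: "disjoint {C (2 * i - 1), C (2 * i)}"
      by (auto simp: disjoint_def)
    have F: "?F i = C (2 * i - 1) \<union> C (2 * i)" using True by (simp add: J_def)
    show ?thesis
      using pairs[OF i']
    proof
      assume "C (2 * i - 1) \<union> C (2 * i) \<in> sets_C2 m A T M"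
      then have "?P (?F i)"
        using sets_C2_circuit_splitting[OF fin assms(2)] F by simp
      then show ?thesis by (intro exI[of _ "{?F i}"]) simp
    next
      assume "PT_circuit m A T M (C (2 * i - 1)) \<and> PT_circuit m A T M (C (2 * i))"
      then show ?thesis
        using two F by (intro exI[of _ "{C (2 * i - 1), C (2 * i)}"]) (auto simp: PT_circuit_def)
    qed
  next
    case False
    then have "?P (C i)" "?F i = C i"
      using i circuits_C0_circuit_splitting[OF fin assms(2) singles[of i]] by (auto simp: J_def)
    then show ?thesis by (intro exI[of _ "{C i}"]) simp
  qed
  moreover have "disjoint_family_on ?F ?I"
    unfolding disjoint_family_on_def
  proof (intro ballI impI)
    fix i j assume ij: "i \<in> ?I" "j \<in> ?I" "i \<noteq> j"
    have "C a \<inter> C b = {}" if "a \<in> J i" "b \<in> J j" for a b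
    proof (rule C_disj)
      show "a \<in> {1..k}" "b \<in> {1..k}" using J_sub ij that by blast+
      show "a \<noteq> b" using J_disj[OF ij] that by blast
    qed
    then show "?F i \<inter> ?F j = {}" by auto
  qed
  ultimately have "?Q (\<Union>i\<in>?I. ?F i)"
    by (rule disjoint_decomposition_UN)
  moreover have "(\<Union>i\<in>?I. ?F i) = ground M"
    by (simp only: E J_cover[symmetric] UN_UN_flatten)
  ultimately show ?thesis
    unfolding eulerian_def by (simp add: splitting_matroid_def)
qed

end
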